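(* Let $g,b,z_d\in\mathbb{R}$ and $M_2>0$. Let $q_{op}$ be the minimizer of $J_2$ over $\mathbb{R}$ and, for $h=x_0/n$ with $n\ge1$ an integer, let $q^h_{op}$ be the minimizer of $J_2^h$ over $\mathbb{R}$. (a) $$q^h_{op}=q_{op}-B_1\frac{gh}6-B_2\frac{gh^2}{24x_0},\qquad B_1=B_2=\left(\tfrac13+\tfrac{M_2}{x_0^3}\right)^{-1}.$$ (b) There are constants $C_8,C_9$ independent of $h$ such that, as $h\to0$ ($h=x_0/n$, $n\to\infty$), $$|q^h_{op}-q_{op}|=C_8h+o(h),\qquad|J_2^h(q^h_{op})-J_2(q_{op})|=C_9h+o(h).$$
   Context: Fix $x_0,y_0>0$, $\Omega=(0,x_0)\times(0,y_0)$, $\Gamma_2=\{x_0\}\times(0,y_0]$, $H=L^2(\Omega)$, $Q=L^2(\Gamma_2)$ with their standard norms. For constants $g,q,b\in\mathbb{R}$, the system $-\Delta u=g$ in $\Omega$, $u=b$ on $\{0\}\times(0,y_0]$, $-\partial u/\partial n=q$ on $\Gamma_2$, $-\partial u/\partial n=0$ on $[0,x_0]\times\{0,y_0\}$ has solution $u_q(x,y)=-\tfrac12gx^2+(gx_0-q)x+b$. For an integer $n\ge1$, $h=x_0/n$, $x_i=(i-1)h$, its discrete (finite-difference, piecewise linear) approximation is $u^h_q(x,y)=(gx_0-q-hgi)x+h^2g\tfrac{i(i-1)}2+b$ for $x\in[x_i,x_{i+1}]$, $y\in[0,y_0]$, $i=1,\dots,n$. For fixed $g,b,z_d\in\mathbb{R}$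 and $M_2>0$ the cost functions on $\mathbb{R}$ are $J_2(q)=\tfrac12\|u_q-z_d\|_H^2+\tfrac{M_2}2\|q\|_Q^2$ and $J^h_2(q)=\tfrac12\|u^h_q-z_d\|_H^2+\tfrac{M_2}2\|q\|_Q^2$, where $\|q\|_Q^2=y_0q^2$ for constant $q$. The minimizer of $J_2$ is $q_{op}=\dfrac{\frac5{12}gx_0^2+(b-z_d)}{2x_0\left(\frac13+\frac{M_2}{x_0^3}\right)}$. *)

theory Defs
  imports "HOL-Analysis.Analysis" "HOL-Library.Landau_Symbols"
begin

definition Omega :: "real \<Rightarrow> real \<Rightarrow> (real \<times> real) set" where
  "Omega x0 y0 = {0<..<x0} \<times> {0<..<y0}"

definition H_norm :: "real \<Rightarrow> real \<Rightarrow> (real \<times> real \<Rightarrow> real) \<Rightarrow> real" where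
  "H_norm x0 y0 f = sqrt (LINT p:Omega x0 y0|lborel. (f p)\<^sup>2)"

text \<open>The boundary part \<open>{x0} \<times> {0<..y0}\<close> is parametrised by arc length through \<open>y \<mapsto> (x0, y)\<close>.\<close>

definition Q_norm :: "real \<Rightarrow> real \<Rightarrow> (real \<times> real \<Rightarrow> real) \<Rightarrow> real" where
  "Q_norm x0 y0 f = sqrt (LINT y:{0<..y0}|lborel. (f (x0, y))\<^sup>2)"

lemma Q_norm_const:
  assumes "y0 > 0"
  shows "(Q_norm x0 y0 (\<lambda>_. q))\<^sup>2 = y0 * q\<^sup>2"
  using assms by (simp add: Q_norm_def set_lebesgue_integral_def)

definition u :: "real \<Rightarrow> real \<Rightarrow> real \<Rightarrow> real \<Rightarrow> real \<times> real \<Rightarrow> real" where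
  "u x0 g b q = (\<lambda>(x, y). - (1/2) * g * x\<^sup>2 + (g * x0 - q) * x + b)"

text \<open>The function \<open>u x0 g b q\<close> solves the mixed boundary value problem.\<close>

lemma u_equation:
  "- (deriv (\<lambda>s. deriv (\<lambda>r. u x0 g b q (r, y)) s) x +
      deriv (\<lambda>s. deriv (\<lambda>r. u x0 g b q (x, r)) s) y) = g"
proof -
  have 1: "deriv (\<lambda>r. u x0 g b q (r, y)) s = - g * s + (g * x0 - q)" for s
    unfolding u_def by (rule DERIV_imp_deriv) (auto intro!: derivative_eq_intros)
  have 2: "deriv (\<lambda>s. - g * s + (g * x0 - q)) x = - g"
    by (rule DERIV_imp_deriv) (auto intro!: derivative_eq_intros)
  show ?thesis unfolding 1 2 by (simp add: u_def)
qed

lemma u_boundary: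
  "u x0 g b q (0, y) = b"
  "- deriv (\<lambda>r. u x0 g b q (r, y)) x0 = q"
  "- deriv (\<lambda>r. u x0 g b q (x, r)) y0 = 0"
  "deriv (\<lambda>r. u x0 g b q (x, r)) 0 = 0"
proof -
  have "deriv (\<lambda>r. u x0 g b q (r, y)) x0 = - q"
    unfolding u_def by (rule DERIV_imp_deriv) (auto intro!: derivative_eq_intros)
  then show "- deriv (\<lambda>r. u x0 g b q (r, y)) x0 = q" by simp
qed (simp_all add: u_def)

definition node :: "real \<Rightarrow> nat \<Rightarrow> nat \<Rightarrow> real" where
  "node x0 n i = (real i - 1) * (x0 / real n)"

text \<open>The index \<open>i \<ge> 1\<close> of a cell \<open>{node x0 n i..node x0 n (i + 1)}\<close> containing \<open>x\<close>. At an
  interior node two cells qualify, and the left one is taken; by \<open>uh_on_cell\<close> below the value of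
  the discrete solution does not depend on this choice.\<close>

definition cell :: "real \<Rightarrow> nat \<Rightarrow> real \<Rightarrow> nat" where
  "cell x0 n x = max 1 (nat \<lceil>x / (x0 / real n)\<rceil>)"

definition uh :: "real \<Rightarrow> real \<Rightarrow> real \<Rightarrow> nat \<Rightarrow> real \<Rightarrow> real \<times> real \<Rightarrow> real" where
  "uh x0 g b n q = (\<lambda>(x, y).
     let h = x0 / real n; i = real (cell x0 n x)
     in (g * x0 - q - h * g * i) * x + h\<^sup>2 * g * (i * (i - 1) / 2) + b)"

lemma cell_bounds:
  assumes "x0 > 0" "n \<ge> 1" "0 \<le> x" "x \<le> x0"
  shows "cell x0 n x \<in> {1..n}" "x \<in> {node x0 n (cell x0 n x)..node x0 n (cell x0 n x + 1)}"
proof -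
  define h where "h = x0 / real n"
  have h: "h > 0" and nh: "real n * h = x0" using assms by (auto simp: h_def)
  define t where "t = x / h"
  have t: "x = t * h" "0 \<le> t" using h assms by (auto simp: t_def)
  have "t * h \<le> real n * h" using t nh assms by simp
  then have tn: "t \<le> real n" using h by (simp only: mult_le_cancel_right_pos)
  have c: "cell x0 n x = max 1 (nat \<lceil>t\<rceil>)" by (simp add: cell_def t_def h_def)
  show "cell x0 n x \<in> {1..n}" using assms tn by (auto simp: c)
  have "real (cell x0 n x) - 1 \<le> t \<and> t \<le> real (cell x0 n x)"
    using t(2) unfolding c by (simp add: max_def) linarith
  then show "x \<in> {node x0 n (cell x0 n x)..node x0 n (cell x0 n x + 1)}"
    using h by (simp add: node_def t(1) flip: h_def)
qed

lemma uh_on_cell: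
  assumes "x0 > 0" "n \<ge> 1" "i \<in> {1..n}" "x \<in> {node x0 n i..node x0 n (i + 1)}" "h = x0 / real n"
  shows "uh x0 g b n q (x, y) =
    (g * x0 - q - h * g * real i) * x + h\<^sup>2 * g * (real i * (real i - 1) / 2) + b"
proof -
  have h: "h > 0" using assms by simp
  define t where "t = x / h"
  have x: "x = t * h" using h by (simp add: t_def)
  have "(real i - 1) * h \<le> t * h" "t * h \<le> real i * h"
    using assms(4) by (simp_all add: node_def x flip: assms(5))
  then have t: "real i - 1 \<le> t" "t \<le> real i" using h by simp_all
  have c: "cell x0 n x = max 1 (nat \<lceil>t\<rceil>)" by (simp add: cell_def t_def assms(5))
  have "cell x0 n x = i \<or> (t = real i - 1 \<and> real i - 1 = real (cell x0 n x))"
  proof (cases "t = real i - 1")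
    case True
    then have "\<lceil>t\<rceil> = int i - 1" by (simp add: ceiling_unique)
    then show ?thesis using True assms(3) unfolding c by (cases "i = 1") (auto simp: max_def)
  next
    case False
    then have "\<lceil>t\<rceil> = int i" using t by (intro ceiling_unique) auto
    then show ?thesis using assms(3) unfolding c by auto
  qed
  then show ?thesis
  proof
    assume "cell x0 n x = i"
    then show ?thesis by (simp add: uh_def Let_def flip: assms(5))
  next
    assume a: "t = real i - 1 \<and> real i - 1 = real (cell x0 n x)"
    then have i: "real i = t + 1" "real (cell x0 n x) = t" by auto
    show ?thesis
      unfolding uh_def Let_def prod.case assms(5)[symmetric] i
      by (simp add: x field_simps power2_eq_square)
  qed
qed

definition J2 :: "real \<Rightarrow> real \<Rightarrow> real \<Rightarrow> real \<Rightarrow> real \<Rightarrow> real \<Rightarrow> real \<Rightarrow> real" where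
  "J2 x0 y0 g b z_d M2 q =
     1/2 * (H_norm x0 y0 (\<lambda>p. u x0 g b q p - z_d))\<^sup>2 + M2/2 * (Q_norm x0 y0 (\<lambda>_. q))\<^sup>2"

definition J2h :: "real \<Rightarrow> real \<Rightarrow> real \<Rightarrow> real \<Rightarrow> real \<Rightarrow> real \<Rightarrow> nat \<Rightarrow> real \<Rightarrow> real" where
  "J2h x0 y0 g b z_d M2 n q =
     1/2 * (H_norm x0 y0 (\<lambda>p. uh x0 g b n q p - z_d))\<^sup>2 + M2/2 * (Q_norm x0 y0 (\<lambda>_. q))\<^sup>2"

lemma quadratic_ex1_arg_min:
  fixes a c d :: real
  assumes "a > 0" and J: "\<And>q. J q = a * q\<^sup>2 + c * q + d"
  shows "\<exists>!q. is_arg_min J (\<lambda>_. True) q"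
proof -
  define m where "m = - c / (2 * a)"
  have J': "J q = J m + a * (q - m)\<^sup>2" for q
    using \<open>a > 0\<close> unfolding J m_def by (simp add: field_simps power2_eq_square)
  have "is_arg_min J (\<lambda>_. True) q \<longleftrightarrow> q = m" for q
  proof
    assume "is_arg_min J (\<lambda>_. True) q"
    then have "J q \<le> J m" by (simp add: is_arg_min_linorder)
    then have "a * (q - m)\<^sup>2 \<le> 0" using J'[of q] by simp
    then show "q = m" using \<open>a > 0\<close> by (simp add: mult_le_0_iff)
  next
    assume "q = m"
    moreover have "J m \<le> J r" for r using J'[of r] \<open>a > 0\<close> by simp
    ultimately show "is_arg_min J (\<lambda>_. True) q" by (simp add: is_arg_min_linorder)
  qed
  then show ?thesis by simp
qed

lemma set_integrable_Omega:
  fixes f :: "real \<times> real \<Rightarrow> real"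
  assumes "f \<in> borel_measurable borel" "\<And>p. p \<in> Omega x0 y0 \<Longrightarrow> \<bar>f p\<bar> \<le> C"
  shows "set_integrable lborel (Omega x0 y0) f"
proof -
  have O: "Omega x0 y0 = box (0, 0) (x0, y0)"
    by (auto simp: Omega_def box_def Basis_prod_def)
  have "emeasure lborel (Omega x0 y0) < \<infinity>"
    unfolding O by (rule emeasure_lborel_box_finite)
  moreover have "Omega x0 y0 \<in> sets lborel" unfolding O by simp
  ultimately have "set_integrable lborel (Omega x0 y0) (\<lambda>_. C)"
    unfolding set_integrable_def by simp
  then show ?thesis
    by (rule set_integrable_bound)
       (use assms \<open>Omega x0 y0 \<in> sets lborel\<close> in
         \<open>auto simp: set_borel_measurable_def intro!: AE_I2 order_trans[OF _ abs_ge_self]\<close>)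
qed

lemma continuous_on_compact_bound:
  fixes f :: "'a::topological_space \<Rightarrow> real"
  assumes "compact S" "continuous_on S f"
  obtains C where "\<And>p. p \<in> S \<Longrightarrow> \<bar>f p\<bar> \<le> C"
proof -
  have "bounded (f ` S)" using assms by (intro compact_imp_bounded compact_continuous_image)
  then show ?thesis using that by (auto simp: bounded_iff)
qed

lemma cost_ex1_arg_min:
  assumes "y0 > 0" "M > 0" "f \<in> borel_measurable borel"
    and bounded: "\<exists>C. \<forall>p \<in> Omega x0 y0. \<bar>f p\<bar> \<le> C"
    and v: "\<And>q x y. v q (x, y) = f (x, y) - q * x"
  shows "\<exists>!q. is_arg_min
    (\<lambda>q. 1/2 * (H_norm x0 y0 (v q))\<^sup>2 + M/2 * (Q_norm x0 y0 (\<lambda>_. q))\<^sup>2) (\<lambda>_. True) q"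
proof -
  let ?I = "\<lambda>f. LINT p:Omega x0 y0|lborel. (f p :: real)"
  obtain C where C: "\<And>p. p \<in> Omega x0 y0 \<Longrightarrow> \<bar>f p\<bar> \<le> C" using bounded by blast
  note [measurable] = assms(3)
  have [measurable]: "(fst :: real \<times> real \<Rightarrow> real) \<in> borel_measurable borel"
    by (intro borel_measurable_continuous_onI continuous_intros)
  have x: "\<bar>fst p\<bar> \<le> \<bar>x0\<bar>" if "p \<in> Omega x0 y0" for p using that by (auto simp: Omega_def)
  have i1: "set_integrable lborel (Omega x0 y0) (\<lambda>p. (f p)\<^sup>2)"
  proof (rule set_integrable_Omega[where C = "C\<^sup>2"])
    fix p assume "p \<in> Omega x0 y0"
    from power_mono[OF C[OF this], of 2] show "\<bar>(f p)\<^sup>2\<bar> \<le> C\<^sup>2" by simp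
  qed measurable
  have i2: "set_integrable lborel (Omega x0 y0) (\<lambda>p. f p * fst p)"
  proof (rule set_integrable_Omega[where C = "C * \<bar>x0\<bar>"])
    fix p assume p: "p \<in> Omega x0 y0"
    then have "0 \<le> C" using C[OF p] by linarith
    then show "\<bar>f p * fst p\<bar> \<le> C * \<bar>x0\<bar>"
      using mult_mono[OF C[OF p] x[OF p]] by (simp add: abs_mult)
  qed measurable
  have i3: "set_integrable lborel (Omega x0 y0) (\<lambda>p. (fst p)\<^sup>2)"
  proof (rule set_integrable_Omega[where C = "x0\<^sup>2"])
    fix p assume "p \<in> Omega x0 y0"
    from power_mono[OF x[OF this], of 2] show "\<bar>(fst p)\<^sup>2\<bar> \<le> x0\<^sup>2" by simp
  qed measurable
  have nn: "?I (\<lambda>p. (w p)\<^sup>2) \<ge> 0" for w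
    unfolding set_lebesgue_integral_def by (rule Bochner_Integration.integral_nonneg) simp
  have e: "(H_norm x0 y0 (v q))\<^sup>2 =
      ?I (\<lambda>p. (f p)\<^sup>2) - 2 * q * ?I (\<lambda>p. f p * fst p) + q\<^sup>2 * ?I (\<lambda>p. (fst p)\<^sup>2)" for q
  proof -
    have "(H_norm x0 y0 (v q))\<^sup>2 = ?I (\<lambda>p. (v q p)\<^sup>2)"
      by (simp add: H_norm_def nn)
    also have "(\<lambda>p. (v q p)\<^sup>2) =
        (\<lambda>p. (f p)\<^sup>2 - 2 * q * (f p * fst p) + q\<^sup>2 * (fst p)\<^sup>2)"
      by (auto simp: v power2_eq_square algebra_simps)
    also have "?I \<dots> = ?I (\<lambda>p. (f p)\<^sup>2) - 2 * q * ?I (\<lambda>p. f p * fst p) + q\<^sup>2 * ?I (\<lambda>p. (fst p)\<^sup>2)"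
      using i1 i2 i3 by (simp add: set_integral_add set_integral_diff)
    finally show ?thesis .
  qed
  show ?thesis
  proof (rule quadratic_ex1_arg_min)
    show "0 < 1/2 * ?I (\<lambda>p. (fst p)\<^sup>2) + M/2 * y0"
      using nn[of fst] assms(1,2) by (intro add_nonneg_pos) auto
    show "1/2 * (H_norm x0 y0 (v q))\<^sup>2 + M/2 * (Q_norm x0 y0 (\<lambda>_. q))\<^sup>2 =
        (1/2 * ?I (\<lambda>p. (fst p)\<^sup>2) + M/2 * y0) * q\<^sup>2 + (- ?I (\<lambda>p. f p * fst p)) * q
          + 1/2 * ?I (\<lambda>p. (f p)\<^sup>2)" for q
      unfolding e Q_norm_const[OF assms(1)] by (simp add: algebra_simps)
  qed
qed

lemma J2_ex1_arg_min:
  assumes "x0 > 0" "y0 > 0" "M2 > 0"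
  shows "\<exists>!q. is_arg_min (J2 x0 y0 g b z_d M2) (\<lambda>_. True) q"
  unfolding J2_def
proof (rule cost_ex1_arg_min)
  let ?f = "\<lambda>p::real \<times> real. - (1/2) * g * (fst p)\<^sup>2 + g * x0 * fst p + b - z_d"
  show "?f \<in> borel_measurable borel"
    by (intro borel_measurable_continuous_onI continuous_intros)
  have "compact (cbox (0, 0) (x0, y0))" "continuous_on (cbox (0, 0) (x0, y0)) ?f"
    by (intro compact_cbox continuous_intros)+
  then obtain C where C: "\<And>p. p \<in> cbox (0, 0) (x0, y0) \<Longrightarrow> \<bar>?f p\<bar> \<le> C"
    using continuous_on_compact_bound by blast
  have "Omega x0 y0 \<subseteq> cbox (0, 0) (x0, y0)" by (auto simp: Omega_def cbox_def Basis_prod_def)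
  then show "\<exists>C. \<forall>p \<in> Omega x0 y0. \<bar>?f p\<bar> \<le> C" using C by blast
qed (use assms in \<open>auto simp: u_def algebra_simps\<close>)

lemma J2h_ex1_arg_min:
  assumes "x0 > 0" "y0 > 0" "M2 > 0" "n \<ge> 1"
  shows "\<exists>!q. is_arg_min (J2h x0 y0 g b z_d M2 n) (\<lambda>_. True) q"
  unfolding J2h_def
proof (rule cost_ex1_arg_min)
  define h where "h = x0 / real n"
  have "cell x0 n \<in> borel \<rightarrow>\<^sub>M count_space UNIV" unfolding cell_def by measurable
  then have [measurable]: "(\<lambda>x. real (cell x0 n x)) \<in> borel_measurable borel" by measurable
  have [measurable]: "(fst :: real \<times> real \<Rightarrow> real) \<in> borel_measurable borel"
    by (intro borel_measurable_continuous_onI continuous_intros)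
  let ?F = "\<lambda>i x. (g * x0 - h * g * i) * x + h\<^sup>2 * g * (i * (i - 1) / 2) + b - z_d"
  let ?f = "\<lambda>p::real \<times> real. ?F (real (cell x0 n (fst p))) (fst p)"
  show "?f \<in> borel_measurable borel" by measurable
  let ?K = "{0..real n} \<times> {0..x0}"
  have "compact ?K" "continuous_on ?K (\<lambda>r. ?F (fst r) (snd r))"
    by (intro compact_Times compact_Icc continuous_intros; simp)+
  then obtain C where C: "\<And>r. r \<in> ?K \<Longrightarrow> \<bar>?F (fst r) (snd r)\<bar> \<le> C"
    using continuous_on_compact_bound by blast
  have "\<bar>?f p\<bar> \<le> C" if "p \<in> Omega x0 y0" for p
  proof -
    have "0 \<le> fst p" "fst p \<le> x0" using that by (auto simp: Omega_def)
    with cell_bounds(1)[OF assms(1,4) this] have "(real (cell x0 n (fst p)), fst p) \<in> ?K" by auto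
    from C[OF this] show ?thesis by simp
  qed
  then show "\<exists>C. \<forall>p \<in> Omega x0 y0. \<bar>?f p\<bar> \<le> C" by blast
qed (use assms in \<open>auto simp: uh_def Let_def algebra_simps\<close>)

end

theory Submission imports Defs
begin

text \<open>Subtracting \<open>z_d\<close> from either state leaves \<open>f x - q * x\<close>, where \<open>f\<close> is independent of the
  control \<open>q\<close>: the response of the state to the control is \<open>- x\<close>, and discretization reproduces it
  exactly. Both cost functions are therefore parabolas in \<open>q\<close>, namely
  \<open>y0 * (A / 2 - q * B + q\<^sup>2 / 2 * D)\<close> with \<open>A = \<integral>f\<^sup>2\<close>, \<open>B = \<integral>x f\<close> over \<open>{0..x0}\<close> and the same
  \<open>D = x0^3 / 3 + M2\<close> for both (\<open>cost_eq\<close>). The minimum is \<open>y0 * (A / 2 - B\<^sup>2 / (2 * D))\<close>, attained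
  at \<open>B / D\<close> (\<open>arg_min_cost\<close>).

  Passing to the discrete state replaces \<open>f\<close> by \<open>f - w\<close>, where \<open>w\<close> is the state error, so the
  minimizer moves by exactly \<open>- (\<integral>x w) / D\<close>. On every cell \<open>w\<close> is the linear function
  \<open>g * h * x / 2\<close> plus the error of interpolating the parabola \<open>u\<close> linearly on that cell
  (\<open>state_error_on_cell\<close>). The first part contributes \<open>g * h * x0^3 / 6\<close> to \<open>\<integral>x w\<close> and the second
  \<open>g * h\<^sup>2 * x0\<^sup>2 / 24\<close> (\<open>state_error_moment\<close>), and these are the two corrections in the formula for the
  discrete minimizer.

  For the optimal costs, \<open>\<integral>(f - w)\<^sup>2 - \<integral>f\<^sup>2 = - g * h * B\<close> up to \<open>O(h\<^sup>2)\<close>, since the interpolation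
  part of \<open>w\<close> is itself \<open>O(h\<^sup>2)\<close> (\<open>state_error_bounds\<close>). The difference of the two minima is
  then, again up to \<open>O(h\<^sup>2)\<close>, the multiple \<open>- (y0 * g * B / 2) * (1 - x0^3 / (3 * D))\<close> of \<open>h\<close>, and
  this factor equals \<open>- y0 * g * M2 * q_op / 2\<close>.\<close>

section \<open>The cost of a function of the first coordinate\<close>

lemma bounded_borel_set_integrable_Icc:
  fixes f :: "real \<Rightarrow> real"
  assumes "f \<in> borel_measurable borel" "\<And>x. x \<in> {0..a} \<Longrightarrow> \<bar>f x\<bar> \<le> C"
  shows "set_integrable lborel {0..a} f"
proof (rule set_integrable_bound)
  show "set_integrable lborel {0..a} (\<lambda>_. C)"
    by (rule borel_integrable_atLeastAtMost') simp
qed (use assms in \<open>auto simp: set_borel_measurable_def intro!: AE_I2 order_trans[OF _ abs_ge_self]\<close>)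

lemma bounded_borel_integrable_Icc:
  fixes f :: "real \<Rightarrow> real"
  assumes "f \<in> borel_measurable borel" "\<And>x. x \<in> {0..a} \<Longrightarrow> \<bar>f x\<bar> \<le> C"
  shows "f integrable_on {0..a}"
  using set_borel_integral_eq_integral(1)[OF bounded_borel_set_integrable_Icc[OF assms]] .

lemma set_integral_Omega_fst:
  fixes f :: "real \<Rightarrow> real"
  assumes "y0 > 0" and f[measurable]: "f \<in> borel_measurable borel"
    and C: "\<And>x. x \<in> {0..x0} \<Longrightarrow> \<bar>f x\<bar> \<le> C"
  shows "(LINT p:Omega x0 y0|lborel. f (fst p)) = y0 * integral {0..x0} f"
proof -
  have fst_m[measurable]: "(fst :: real \<times> real \<Rightarrow> real) \<in> borel_measurable borel"
    by (intro borel_measurable_continuous_onI continuous_intros)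
  have "set_integrable lborel (Omega x0 y0) (\<lambda>p. f (fst p))"
    by (rule set_integrable_Omega[where C = C]) (use C in \<open>auto simp: Omega_def\<close>)
  then have int: "integrable (lborel \<Otimes>\<^sub>M lborel) (\<lambda>p. indicator (Omega x0 y0) p *\<^sub>R f (fst p))"
    unfolding lborel_prod set_integrable_def .
  have "(LINT p:Omega x0 y0|lborel. f (fst p)) =
      (\<integral>x. \<integral>y. indicator (Omega x0 y0) (x, y) *\<^sub>R f (fst (x, y)) \<partial>lborel \<partial>lborel)"
    unfolding set_lebesgue_integral_def lborel_prod[symmetric]
    by (rule lborel_pair.integral_fst'[OF int, symmetric])
  also have "\<dots> = (\<integral>x. y0 * (indicator {0<..<x0} x * f x) \<partial>lborel)"
    using \<open>y0 > 0\<close> by (simp add: Omega_def indicator_times mult_ac)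
  also have "\<dots> = y0 * (LINT x:{0<..<x0}|lborel. f x)"
    by (simp add: set_lebesgue_integral_def)
  also have "(LINT x:{0<..<x0}|lborel. f x) = (LINT x:{0..x0}|lborel. f x)"
    by (rule set_integral_discrete_difference[where X = "{0, x0}"]) auto
  also have "\<dots> = integral {0..x0} f"
    by (rule set_borel_integral_eq_integral(2)[OF bounded_borel_set_integrable_Icc[OF f C]])
  finally show ?thesis .
qed

text \<open>The coefficient of \<open>q\<^sup>2\<close> does not involve \<open>f\<close>, because \<open>\<integral>x\<^sup>2 = x0^3 / 3\<close> is the squared norm of
  the response to the control. Applied to the continuous and to the discrete state, the lemma gives
  two parabolas of the same curvature, which makes their minimizers comparable.\<close>

lemma cost_eq:
  fixes f :: "real \<Rightarrow> real"
  assumes "x0 > 0" "y0 > 0" and f[measurable]: "f \<in> borel_measurable borel"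
    and C: "\<And>x. x \<in> {0..x0} \<Longrightarrow> \<bar>f x\<bar> \<le> C"
    and v: "\<And>x y. v (x, y) = f x - q * x"
  shows "1/2 * (H_norm x0 y0 v)\<^sup>2 + M/2 * (Q_norm x0 y0 (\<lambda>_. q))\<^sup>2 =
    y0 * (integral {0..x0} (\<lambda>x. (f x)\<^sup>2) / 2 - q * integral {0..x0} (\<lambda>x. x * f x)
      + q\<^sup>2 / 2 * (x0 ^ 3 / 3 + M))"
proof -
  have bd: "\<bar>f x - q * x\<bar> \<le> C + \<bar>q\<bar> * x0" if "x \<in> {0..x0}" for x
  proof -
    have "\<bar>q * x\<bar> \<le> \<bar>q\<bar> * x0" using that by (simp add: abs_mult mult_left_mono)
    then show ?thesis using C[OF that] by linarith
  qed
  have "0 \<le> C" using C[of 0] \<open>x0 > 0\<close> by simp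
  have i1: "(\<lambda>x. (f x)\<^sup>2) integrable_on {0..x0}"
    using power_mono[OF C, of _ 2] by (intro bounded_borel_integrable_Icc[where C = "C\<^sup>2"]) auto
  have i2: "(\<lambda>x. x * f x) integrable_on {0..x0}"
    using \<open>0 \<le> C\<close> C by (intro bounded_borel_integrable_Icc[where C = "x0 * C"])
      (auto simp: abs_mult intro!: mult_mono)
  have x3: "((\<lambda>x. x\<^sup>2) has_integral x0 ^ 3 / 3) {0..x0}"
  proof -
    have "((\<lambda>x. x\<^sup>2) has_integral x0 ^ 3 / 3 - 0 ^ 3 / 3) {0..x0}"
      using \<open>x0 > 0\<close> by (intro fundamental_theorem_of_calculus)
        (auto intro!: derivative_eq_intros
          simp: has_real_derivative_iff_has_vector_derivative[symmetric])
    then show ?thesis by simp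
  qed
  have "(H_norm x0 y0 v)\<^sup>2 = (LINT p:Omega x0 y0|lborel. (v p)\<^sup>2)"
    by (simp add: H_norm_def set_lebesgue_integral_def Bochner_Integration.integral_nonneg)
  also have "(\<lambda>p. (v p)\<^sup>2) = (\<lambda>p. (f (fst p) - q * fst p)\<^sup>2)"
    by (auto simp: v)
  also have "(LINT p:Omega x0 y0|lborel. (f (fst p) - q * fst p)\<^sup>2) =
      y0 * integral {0..x0} (\<lambda>x. (f x - q * x)\<^sup>2)"
    using power_mono[OF bd, of _ 2]
    by (intro set_integral_Omega_fst[OF \<open>y0 > 0\<close>, where C = "(C + \<bar>q\<bar> * x0)\<^sup>2"]) auto
  also have "integral {0..x0} (\<lambda>x. (f x - q * x)\<^sup>2) =
      integral {0..x0} (\<lambda>x. (f x)\<^sup>2) - 2 * q * integral {0..x0} (\<lambda>x. x * f x) + q\<^sup>2 * (x0 ^ 3 / 3)"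
  proof (rule integral_unique)
    have "((\<lambda>x. (f x)\<^sup>2 - 2 * q * (x * f x) + q\<^sup>2 * x\<^sup>2) has_integral
      integral {0..x0} (\<lambda>x. (f x)\<^sup>2) - 2 * q * integral {0..x0} (\<lambda>x. x * f x) + q\<^sup>2 * (x0 ^ 3 / 3)) {0..x0}"
      by (intro has_integral_add has_integral_diff has_integral_mult_right
          integrable_integral i1 i2 x3)
    then show "((\<lambda>x. (f x - q * x)\<^sup>2) has_integral
      integral {0..x0} (\<lambda>x. (f x)\<^sup>2) - 2 * q * integral {0..x0} (\<lambda>x. x * f x) + q\<^sup>2 * (x0 ^ 3 / 3)) {0..x0}"
      by (simp add: power2_diff power_mult_distrib algebra_simps)
  qed
  finally have H: "(H_norm x0 y0 v)\<^sup>2 = y0 * (integral {0..x0} (\<lambda>x. (f x)\<^sup>2)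
      - 2 * q * integral {0..x0} (\<lambda>x. x * f x) + q\<^sup>2 * (x0 ^ 3 / 3))" .
  show ?thesis unfolding H Q_norm_const[OF \<open>y0 > 0\<close>] by (simp add: field_simps)
qed

lemma arg_min_cost:
  fixes J :: "real \<Rightarrow> real"
  assumes "y > 0" "D > 0" and J: "\<And>q. J q = y * (A / 2 - q * B + q\<^sup>2 / 2 * D)"
    and min: "is_arg_min J (\<lambda>_. True) q"
  shows "q = B / D" "J q = y * (A / 2 - B\<^sup>2 / (2 * D))"
proof -
  have J': "J r = J (B / D) + y * D / 2 * (r - B / D)\<^sup>2" for r
    using \<open>D > 0\<close> unfolding J by (simp add: field_simps power2_eq_square)
  have "J q \<le> J (B / D)" using min by (simp add: is_arg_min_linorder)
  then have "y * D / 2 * (q - B / D)\<^sup>2 \<le> 0" using J'[of q] by linarith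
  then show q: "q = B / D" using assms(1,2) by (simp add: mult_le_0_iff)
  show "J q = y * (A / 2 - B\<^sup>2 / (2 * D))"
    using \<open>D > 0\<close> unfolding q J by (simp add: field_simps power2_eq_square)
qed

section \<open>The discretization error of the state\<close>

text \<open>The control and the Dirichlet datum enter \<^term>\<open>u\<close> and \<^term>\<open>uh\<close> in the same way, so the
  difference of the two states can be taken at the control \<open>0\<close> and the datum \<open>0\<close>.\<close>

definition state_error :: "real \<Rightarrow> real \<Rightarrow> nat \<Rightarrow> real \<Rightarrow> real" where
  "state_error x0 g n x = u x0 g 0 0 (x, 0) - uh x0 g 0 n 0 (x, 0)"

lemma uh_eq: "uh x0 g b n q (x, y) = u x0 g b q (x, y) - state_error x0 g n x"
  by (simp add: state_error_def u_def uh_def Let_def algebra_simps)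

lemma state_error_measurable: "state_error x0 g n \<in> borel_measurable borel"
proof -
  have "cell x0 n \<in> borel \<rightarrow>\<^sub>M count_space UNIV" unfolding cell_def by measurable
  then have [measurable]: "(\<lambda>x. real (cell x0 n x)) \<in> borel_measurable borel" by measurable
  show ?thesis unfolding state_error_def[abs_def] u_def uh_def Let_def prod.case by measurable
qed

text \<open>The discrete boundary condition prescribes the slope \<open>- q\<close> on the whole last cell, while the
  chord of \<open>u\<close> over that cell has slope \<open>- q + g * h / 2\<close>. The second differences at the nodes agree,
  so this defect of the slope is the same on all cells and yields the linear term. What remains is
  the error of piecewise linear interpolation of a function with second derivative \<open>- g\<close>.\<close>

lemma state_error_on_cell:
  assumes "x0 > 0" "k < n" "x \<in> {real k * h..real (Suc k) * h}" "h = x0 / real n"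
  shows "state_error x0 g n x = g * h * x / 2 + g / 2 * ((x - real k * h) * (real (Suc k) * h - x))"
proof -
  have "uh x0 g 0 n 0 (x, 0) =
      (g * x0 - 0 - h * g * real (Suc k)) * x + h\<^sup>2 * g * (real (Suc k) * (real (Suc k) - 1) / 2) + 0"
    by (rule uh_on_cell) (use assms in \<open>auto simp: node_def\<close>)
  then show ?thesis
    by (simp add: state_error_def u_def field_simps power2_eq_square)
qed

lemma state_error_bounds:
  assumes "x0 > 0" "n \<ge> 1" "x \<in> {0..x0}" "h = x0 / real n"
  shows "\<bar>state_error x0 g n x - g * h * x / 2\<bar> \<le> \<bar>g\<bar> * h\<^sup>2"
    and "\<bar>state_error x0 g n x\<bar> \<le> 2 * \<bar>g\<bar> * x0 * h"
proof -
  have h: "h > 0" "h \<le> x0" using assms by (simp_all add: divide_le_eq)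
  define k where "k = cell x0 n x - 1"
  have cell: "cell x0 n x = Suc k" "k < n" using cell_bounds(1)[of x0 n x] assms by (auto simp: k_def)
  have x: "x \<in> {real k * h..real (Suc k) * h}"
    using cell_bounds(2)[of x0 n x] assms unfolding cell(1) by (simp add: node_def)
  define s where "s = (x - real k * h) * (real (Suc k) * h - x)"
  have s: "0 \<le> s" "s \<le> h * h"
  proof -
    have d: "0 \<le> x - real k * h" "x - real k * h \<le> h" "0 \<le> real (Suc k) * h - x" "real (Suc k) * h - x \<le> h"
      using x by (simp_all add: algebra_simps)
    show "0 \<le> s" unfolding s_def by (rule mult_nonneg_nonneg[OF d(1,3)])
    show "s \<le> h * h" unfolding s_def using d h by (intro mult_mono) auto
  qed
  have e: "state_error x0 g n x = g * h * x / 2 + g / 2 * s"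
    unfolding s_def by (rule state_error_on_cell[OF assms(1) cell(2) x assms(4)])
  have "\<bar>g\<bar> * s \<le> \<bar>g\<bar> * (h * h)" using s by (intro mult_left_mono) auto
  then have gs: "\<bar>g * s\<bar> \<le> \<bar>g\<bar> * h\<^sup>2" using s by (simp add: abs_mult power2_eq_square)
  then show 1: "\<bar>state_error x0 g n x - g * h * x / 2\<bar> \<le> \<bar>g\<bar> * h\<^sup>2"
    unfolding e by simp
  have "\<bar>g * h * x\<bar> \<le> \<bar>g\<bar> * h * x0"
    using h assms(3) by (auto simp: abs_mult intro!: mult_left_mono)
  moreover have "\<bar>g\<bar> * h\<^sup>2 \<le> \<bar>g\<bar> * h * x0"
    using h by (simp add: power2_eq_square mult_left_mono mult.assoc)
  ultimately show "\<bar>state_error x0 g n x\<bar> \<le> 2 * \<bar>g\<bar> * x0 * h"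
    using 1 by (simp add: mult_ac)
qed

text \<open>The integral up to the node \<open>k * h\<close> is one and the same polynomial in \<open>k * h\<close> for all \<open>k\<close>: on one
  cell the interpolation error contributes \<open>g / 2 * h^3 / 6\<close> times the midpoint of the cell, and the
  midpoint times \<open>h\<close> is half the difference of the squares of the two nodes, so the sum telescopes.\<close>

lemma state_error_moment:
  assumes "x0 > 0" "n \<ge> 1" "h = x0 / real n"
  shows "((\<lambda>x. x * state_error x0 g n x) has_integral g * h * x0 ^ 3 / 6 + g * h\<^sup>2 * x0\<^sup>2 / 24) {0..x0}"
proof -
  have h: "h > 0" using assms by simp
  let ?W = "\<lambda>t. g * h * t ^ 3 / 6 + g * h\<^sup>2 * t\<^sup>2 / 24"
  have "((\<lambda>x. x * state_error x0 g n x) has_integral ?W (real k * h)) {0..real k * h}" if "k \<le> n" for k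
    using that
  proof (induction k)
    case 0
    then show ?case by (simp add: has_integral_refl)
  next
    case (Suc k)
    let ?P = "\<lambda>x. g * h * x ^ 3 / 6 + g / 2 * (- (x ^ 4) / 4 + (2 * real k + 1) * h * x ^ 3 / 3
      - real k * (real k + 1) * h\<^sup>2 * x\<^sup>2 / 2)"
    have le: "real k * h \<le> real (Suc k) * h" using h by (simp add: mult_right_mono)
    have "((\<lambda>x. x * (g * h * x / 2 + g / 2 * ((x - real k * h) * (real (Suc k) * h - x))))
        has_integral ?P (real (Suc k) * h) - ?P (real k * h)) {real k * h..real (Suc k) * h}"
      by (rule fundamental_theorem_of_calculus[OF le])
        (auto intro!: derivative_eq_intros
          simp: has_real_derivative_iff_has_vector_derivative[symmetric] field_simps
            power2_eq_square power3_eq_cube)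
    then have "((\<lambda>x. x * state_error x0 g n x)
        has_integral ?P (real (Suc k) * h) - ?P (real k * h)) {real k * h..real (Suc k) * h}"
      by (rule has_integral_eq[rotated])
        (use state_error_on_cell[OF assms(1) _ _ assms(3), of k] Suc.prems in simp)
    from has_integral_combine[OF _ le Suc.IH this]
    have "((\<lambda>x. x * state_error x0 g n x) has_integral
        ?W (real k * h) + (?P (real (Suc k) * h) - ?P (real k * h))) {0..real (Suc k) * h}"
      using Suc.prems h by simp
    also have "?W (real k * h) + (?P (real (Suc k) * h) - ?P (real k * h)) = ?W (real (Suc k) * h)"
      by (simp add: field_simps power2_eq_square power3_eq_cube power4_eq_xxxx)
    finally show ?case .
  qed
  from this[of n] show ?thesis using assms by simp
qed

section \<open>The two minimizers and their costs\<close>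

text \<open>The hypotheses start at index \<open>1\<close> because the mesh size \<open>x0 / real n\<close> takes the default
  value \<open>0\<close> at \<open>n = 0\<close>.\<close>

lemma smallo_of_quadratic_bound:
  fixes h F :: "nat \<Rightarrow> real"
  assumes "h \<longlonglongrightarrow> 0" "\<And>n. n \<ge> 1 \<Longrightarrow> h n > 0" "\<And>n. n \<ge> 1 \<Longrightarrow> \<bar>F n\<bar> \<le> K * (h n)\<^sup>2"
  shows "F \<in> o(h)"
proof (rule smalloI_tendsto)
  show "(\<lambda>n. F n / h n) \<longlonglongrightarrow> 0"
  proof (rule Lim_null_comparison)
    show "\<forall>\<^sub>F n in sequentially. norm (F n / h n) \<le> K * h n"
      using eventually_ge_at_top[of 1]
    proof eventually_elim
      case (elim n)
      then show ?case using assms(2,3)[of n] by (simp add: divide_le_eq power2_eq_square mult.assoc)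
    qed
    show "(\<lambda>n. K * h n) \<longlonglongrightarrow> 0" using tendsto_mult_right_zero[OF assms(1)] by simp
  qed
  show "\<forall>\<^sub>F n in sequentially. h n \<noteq> 0"
    using eventually_ge_at_top[of 1] by eventually_elim (use assms(2) in force)
qed

theorem lemma10:
  fixes x0 y0 g b z_d M2 q_op :: real and qh_op :: "nat \<Rightarrow> real"
  assumes "x0 > 0" and "y0 > 0" and "M2 > 0"
    and "is_arg_min (J2 x0 y0 g b z_d M2) (\<lambda>_. True) q_op"
    and "\<And>n. n \<ge> 1 \<Longrightarrow> is_arg_min (J2h x0 y0 g b z_d M2 n) (\<lambda>_. True) (qh_op n)"
  shows "(\<forall>n\<ge>1.
      let h = x0 / real n;
          B1 = inverse (1/3 + M2 / x0 ^ 3);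
          B2 = inverse (1/3 + M2 / x0 ^ 3)
      in qh_op n = q_op - B1 * (g * h / 6) - B2 * (g * h\<^sup>2 / (24 * x0)))
    \<and> (\<exists>C8 C9 :: real.
        (\<lambda>n. \<bar>qh_op n - q_op\<bar> - C8 * (x0 / real n)) \<in> o(\<lambda>n. x0 / real n)
      \<and> (\<lambda>n. \<bar>J2h x0 y0 g b z_d M2 n (qh_op n) - J2 x0 y0 g b z_d M2 q_op\<bar> - C9 * (x0 / real n))
          \<in> o(\<lambda>n. x0 / real n))"
proof -
  note pos = \<open>x0 > 0\<close> \<open>y0 > 0\<close> \<open>M2 > 0\<close>
  define f where "f = (\<lambda>x. - (1/2) * g * x\<^sup>2 + g * x0 * x + b - z_d)"
  define w where "w = state_error x0 g"
  define h where "h = (\<lambda>n. x0 / real n)"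
  define D where "D = x0 ^ 3 / 3 + M2"
  define A where "A = integral {0..x0} (\<lambda>x. (f x)\<^sup>2)"
  define B where "B = integral {0..x0} (\<lambda>x. x * f x)"
  define Ah where "Ah = (\<lambda>n. integral {0..x0} (\<lambda>x. (f x - w n x)\<^sup>2))"
  define e where "e = (\<lambda>n. g * h n * x0 ^ 3 / 6 + g * (h n)\<^sup>2 * x0\<^sup>2 / 24)"
  have D: "D > 0" using pos by (simp add: D_def add_pos_pos)
  have h: "h n > 0" "h n \<le> x0" if "n \<ge> 1" for n
    using that pos by (auto simp: h_def field_simps)
  have fc: "continuous_on S f" for S unfolding f_def by (intro continuous_intros)
  have f[measurable]: "f \<in> borel_measurable borel"
    by (intro borel_measurable_continuous_onI fc)
  obtain C where C: "\<And>x. x \<in> {0..x0} \<Longrightarrow> \<bar>f x\<bar> \<le> C"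
    using continuous_on_compact_bound[OF compact_Icc fc] by blast
  have C0: "C \<ge> 0" using C[of 0] pos by simp
  have w[measurable]: "w n \<in> borel_measurable borel" for n
    unfolding w_def by (rule state_error_measurable)
  have w1: "\<bar>w n x - g * h n * x / 2\<bar> \<le> \<bar>g\<bar> * (h n)\<^sup>2"
    and w2: "\<bar>w n x\<bar> \<le> 2 * \<bar>g\<bar> * x0 * h n" if "n \<ge> 1" "x \<in> {0..x0}" for n x
    unfolding w_def using state_error_bounds[OF pos(1) that, of "h n" g] by (simp_all add: h_def)
  have fw: "\<bar>f x - w n x\<bar> \<le> C + 2 * \<bar>g\<bar> * x0 * h n" if "n \<ge> 1" "x \<in> {0..x0}" for n x
    using C[OF that(2)] w2[OF that] by linarith
  have int_xf: "(\<lambda>x. x * f x) integrable_on {0..x0}" and int_ff: "(\<lambda>x. (f x)\<^sup>2) integrable_on {0..x0}"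
    by (intro integrable_continuous_real continuous_intros fc)+

  have J: "J2 x0 y0 g b z_d M2 q = y0 * (A / 2 - q * B + q\<^sup>2 / 2 * D)" for q
    unfolding J2_def A_def B_def D_def
    by (rule cost_eq[OF pos(1,2) f C]) (simp_all add: u_def f_def algebra_simps)
  have Jh: "J2h x0 y0 g b z_d M2 n q = y0 * (Ah n / 2 - q * (B - e n) + q\<^sup>2 / 2 * D)"
    if n: "n \<ge> 1" for n q
  proof -
    have "((\<lambda>x. x * f x - x * w n x) has_integral B - e n) {0..x0}"
      unfolding B_def e_def w_def
      by (intro has_integral_diff integrable_integral int_xf state_error_moment[OF pos(1) n])
        (simp add: h_def)
    then have Bh: "integral {0..x0} (\<lambda>x. x * (f x - w n x)) = B - e n"
      by (intro integral_unique) (simp add: algebra_simps)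
    have "J2h x0 y0 g b z_d M2 n q = y0 * (integral {0..x0} (\<lambda>x. (f x - w n x)\<^sup>2) / 2
        - q * integral {0..x0} (\<lambda>x. x * (f x - w n x)) + q\<^sup>2 / 2 * (x0 ^ 3 / 3 + M2))"
      unfolding J2h_def
      by (rule cost_eq[OF pos(1,2) _ fw[OF n]])
        (simp_all add: uh_eq u_def f_def w_def algebra_simps flip: w_def)
    then show ?thesis unfolding Bh Ah_def D_def .
  qed
  note opt = arg_min_cost[OF pos(2) D J assms(4)]
  note opth = arg_min_cost[OF pos(2) D Jh assms(5)]

  have D3: "D = x0 ^ 3 * (1/3 + M2 / x0 ^ 3)" using pos by (simp add: D_def field_simps)
  define \<beta> where "\<beta> = inverse (1/3 + M2 / x0 ^ 3)"
  have \<beta>: "\<beta> = x0 ^ 3 / D" unfolding \<beta>_def D3 using pos by (simp add: inverse_eq_divide)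
  have exact: "qh_op n = q_op - \<beta> * (g * h n / 6) - \<beta> * (g * (h n)\<^sup>2 / (24 * x0))" if "n \<ge> 1" for n
    unfolding opt(1) opth(1)[OF that that] \<beta> e_def using pos D
    by (simp add: field_simps power2_eq_square power3_eq_cube)

  \<comment> \<open>Only the linear part \<open>g * h * x / 2\<close> of the state error is visible to first order in \<open>\<integral>f\<^sup>2\<close>, and its
    contribution is a multiple of \<open>B = \<integral>x f\<close>.\<close>
  have R: "\<bar>Ah n - A + g * h n * B\<bar> \<le> x0 * (2 * C * \<bar>g\<bar> + 4 * g\<^sup>2 * x0\<^sup>2) * (h n)\<^sup>2" if n: "n \<ge> 1" for n
  proof -
    let ?r = "\<lambda>x. (f x - w n x)\<^sup>2 - (f x)\<^sup>2 + g * h n * (x * f x)"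
    let ?K = "(2 * C * \<bar>g\<bar> + 4 * g\<^sup>2 * x0\<^sup>2) * (h n)\<^sup>2"
    have i: "(\<lambda>x. (f x - w n x)\<^sup>2) integrable_on {0..x0}"
      using power_mono[OF fw[OF n], of _ 2]
      by (intro bounded_borel_integrable_Icc[where C = "(C + 2 * \<bar>g\<bar> * x0 * h n)\<^sup>2"]) auto
    have r: "(?r has_integral Ah n - A + g * h n * B) {0..x0}"
      unfolding Ah_def A_def B_def
      by (intro has_integral_add has_integral_diff has_integral_mult_right integrable_integral
          i int_ff int_xf)
    have "norm (?r x) \<le> ?K" if x: "x \<in> {0..x0}" for x
    proof -
      have "?r x = (w n x)\<^sup>2 - 2 * f x * (w n x - g * h n * x / 2)"
        by (simp add: power2_eq_square algebra_simps)
      moreover have "\<bar>f x * (w n x - g * h n * x / 2)\<bar> \<le> C * (\<bar>g\<bar> * (h n)\<^sup>2)"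
        unfolding abs_mult using C0 C[OF x] w1[OF n x] by (intro mult_mono) auto
      moreover have "(w n x)\<^sup>2 \<le> (2 * \<bar>g\<bar> * x0 * h n)\<^sup>2"
        using power_mono[OF w2[OF n x], of 2] by simp
      then have "(w n x)\<^sup>2 \<le> 4 * g\<^sup>2 * x0\<^sup>2 * (h n)\<^sup>2"
        by (simp add: power_mult_distrib)
      moreover have "?K = 2 * (C * (\<bar>g\<bar> * (h n)\<^sup>2)) + 4 * g\<^sup>2 * x0\<^sup>2 * (h n)\<^sup>2"
        by (simp add: algebra_simps)
      moreover have "0 \<le> (w n x)\<^sup>2" by simp
      ultimately show ?thesis unfolding real_norm_def by linarith
    qed
    moreover have "0 \<le> ?K" using C0 by simp
    ultimately have "norm (Ah n - A + g * h n * B) \<le> ?K * measure lborel (cbox 0 x0)"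
      using has_integral_bound[of ?K ?r _ 0 x0] r by simp
    then show ?thesis using pos by (simp add: mult_ac)
  qed
  have e: "\<bar>e n\<bar> \<le> \<bar>g\<bar> * x0 ^ 3 * h n" if n: "n \<ge> 1" for n
  proof -
    have "h n * x0\<^sup>2 * h n \<le> h n * x0\<^sup>2 * x0"
      using h[OF n] by (intro mult_left_mono) auto
    then have "(h n)\<^sup>2 * x0\<^sup>2 \<le> x0 ^ 3 * h n"
      by (simp add: power2_eq_square power3_eq_cube mult_ac)
    moreover have "0 \<le> x0 ^ 3 * h n" using h[OF n] pos by simp
    moreover have "h n * x0 ^ 3 = x0 ^ 3 * h n" by simp
    ultimately have "h n * x0 ^ 3 / 6 + (h n)\<^sup>2 * x0\<^sup>2 / 24 \<le> x0 ^ 3 * h n"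
      by linarith
    then have "\<bar>g\<bar> * (h n * x0 ^ 3 / 6 + (h n)\<^sup>2 * x0\<^sup>2 / 24) \<le> \<bar>g\<bar> * (x0 ^ 3 * h n)"
      by (intro mult_left_mono) auto
    moreover have "e n = g * (h n * x0 ^ 3 / 6 + (h n)\<^sup>2 * x0\<^sup>2 / 24)"
      by (simp add: e_def algebra_simps)
    moreover have "h n * x0 ^ 3 / 6 + (h n)\<^sup>2 * x0\<^sup>2 / 24 \<ge> 0" using h[OF n] pos by simp
    ultimately show ?thesis by (simp add: abs_mult mult.assoc)
  qed

  have h0: "h \<longlonglongrightarrow> 0" unfolding h_def by (rule lim_const_over_n)
  have q_rate: "(\<lambda>n. \<bar>qh_op n - q_op\<bar> - \<beta> * \<bar>g\<bar> / 6 * h n) \<in> o(h)"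
  proof (rule smallo_of_quadratic_bound[OF h0 h(1)])
    fix n :: nat assume n: "n \<ge> 1"
    have "qh_op n - q_op = - (\<beta> * g / 6 * h n + \<beta> * g / (24 * x0) * (h n)\<^sup>2)"
      unfolding exact[OF n] by simp
    moreover have "\<bar>\<beta> * g / 6 * h n\<bar> = \<beta> * \<bar>g\<bar> / 6 * h n"
      "\<bar>\<beta> * g / (24 * x0) * (h n)\<^sup>2\<bar> = \<beta> * \<bar>g\<bar> / (24 * x0) * (h n)\<^sup>2"
      using h(1)[OF n] pos D by (simp_all add: abs_mult \<beta>)
    ultimately show "\<bar>\<bar>qh_op n - q_op\<bar> - \<beta> * \<bar>g\<bar> / 6 * h n\<bar> \<le> \<beta> * \<bar>g\<bar> / (24 * x0) * (h n)\<^sup>2"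
      by linarith
  qed
  \<comment> \<open>The coefficient of \<open>h\<close> in the difference of the minima, before absolute values. The
    factor \<open>M2 = D - x0 ^ 3 / 3\<close> is what remains after the shift of the minimizer has compensated part
    of the change of \<open>\<integral>f\<^sup>2\<close>.\<close>
  define c where "c = - (y0 * g * M2 * q_op / 2)"
  have J_rate: "(\<lambda>n. \<bar>J2h x0 y0 g b z_d M2 n (qh_op n) - J2 x0 y0 g b z_d M2 q_op\<bar> - \<bar>c\<bar> * h n) \<in> o(h)"
  proof (rule smallo_of_quadratic_bound[OF h0 h(1)])
    fix n :: nat assume n: "n \<ge> 1"
    let ?d = "J2h x0 y0 g b z_d M2 n (qh_op n) - J2 x0 y0 g b z_d M2 q_op"
    let ?R = "Ah n - A + g * h n * B"
    define K1 where "K1 = x0 * (2 * C * \<bar>g\<bar> + 4 * g\<^sup>2 * x0\<^sup>2)"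
    define K2 where "K2 = \<bar>B * g * x0\<^sup>2 / (24 * D)\<bar>"
    define K3 where "K3 = (\<bar>g\<bar> * x0 ^ 3)\<^sup>2 / (2 * D)"
    have d: "?d = y0 * ((Ah n - A) / 2 + (2 * B * e n - (e n)\<^sup>2) / (2 * D))"
      unfolding opt(2) opth(2)[OF n n] using D by (simp add: field_simps power2_eq_square)
    have c: "c = y0 * (- (g * B) / 2 + B * g * x0 ^ 3 / (6 * D))"
    proof -
      have M: "M2 = D - x0 ^ 3 / 3" by (simp add: D_def)
      show ?thesis using D unfolding c_def opt(1) M by (simp add: field_simps)
    qed
    define T where "T = B * g * x0 ^ 3 / (6 * D)"
    have "2 * B * e n / (2 * D) = T * h n + B * g * x0\<^sup>2 / (24 * D) * (h n)\<^sup>2"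
      unfolding e_def T_def using D by (simp add: field_simps)
    then have dc: "?d - c * h n =
        y0 * (?R / 2 + B * g * x0\<^sup>2 / (24 * D) * (h n)\<^sup>2 - (e n)\<^sup>2 / (2 * D))"
      unfolding d c T_def[symmetric] diff_divide_distrib[of "2 * B * e n"]
      by (simp only:) (simp add: algebra_simps add_divide_distrib diff_divide_distrib)
    have triangle: "\<bar>r / 2 + s - t\<bar> \<le> k1 + k2 + k3"
      if "\<bar>r\<bar> \<le> k1" "\<bar>s\<bar> = k2" "t \<le> k3" "0 \<le> t" for r s t k1 k2 k3 :: real
      using that by linarith
    have "\<bar>?R\<bar> \<le> K1 * (h n)\<^sup>2" unfolding K1_def by (rule R[OF n])
    moreover have "\<bar>B * g * x0\<^sup>2 / (24 * D) * (h n)\<^sup>2\<bar> = K2 * (h n)\<^sup>2"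
      by (simp add: K2_def abs_mult)
    moreover have "(e n)\<^sup>2 / (2 * D) \<le> K3 * (h n)\<^sup>2"
      using power_mono[OF e[OF n], of 2] D
      by (simp add: K3_def power_mult_distrib divide_right_mono)
    moreover have "0 \<le> (e n)\<^sup>2 / (2 * D)" using D by simp
    ultimately have "\<bar>?R / 2 + B * g * x0\<^sup>2 / (24 * D) * (h n)\<^sup>2 - (e n)\<^sup>2 / (2 * D)\<bar>
        \<le> K1 * (h n)\<^sup>2 + K2 * (h n)\<^sup>2 + K3 * (h n)\<^sup>2"
      by (rule triangle)
    then have "\<bar>?d - c * h n\<bar> \<le> y0 * (K1 * (h n)\<^sup>2 + K2 * (h n)\<^sup>2 + K3 * (h n)\<^sup>2)"
      unfolding dc abs_mult[of y0] using pos by (simp add: mult_left_mono)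
    moreover have "\<bar>c * h n\<bar> = \<bar>c\<bar> * h n" using h(1)[OF n] by (simp add: abs_mult)
    ultimately have "\<bar>\<bar>?d\<bar> - \<bar>c\<bar> * h n\<bar> \<le> y0 * (K1 * (h n)\<^sup>2 + K2 * (h n)\<^sup>2 + K3 * (h n)\<^sup>2)"
      by linarith
    then show "\<bar>\<bar>?d\<bar> - \<bar>c\<bar> * h n\<bar> \<le> y0 * (x0 * (2 * C * \<bar>g\<bar> + 4 * g\<^sup>2 * x0\<^sup>2)
        + \<bar>B * g * x0\<^sup>2 / (24 * D)\<bar> + (\<bar>g\<bar> * x0 ^ 3)\<^sup>2 / (2 * D)) * (h n)\<^sup>2"
      unfolding K1_def[symmetric] K2_def[symmetric] K3_def[symmetric] by (simp add: algebra_simps)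
  qed
  show ?thesis
    using exact q_rate J_rate unfolding Let_def \<beta>_def h_def by blast
qed

end
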